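(* Assume the framework described in the context. Let $\mathcal A,\mathcal B\in\mathcal K$ be separable, let $\hat{\mathcal A}\subseteq\mathcal A$ and $\hat{\mathcal B}\subseteq\mathcal B$ be countable dense sets, and let $\varepsilon>0$. The following are equivalent: (1) there is $\varepsilon'\in(0,\varepsilon)$ such that player II has a winning strategy in $\mathrm{EFR}^{\omega,\varepsilon'}(\hat{\mathcal A},\hat{\mathcal B})$; (2) there are $\varepsilon'\in(0,\varepsilon)$ and an $\varepsilon'$-correspondence $R\in\mathcal R_{\varepsilon'}$ between $\mathcal A$ and $\mathcal B$ with $\mathrm{dom}(R)=\hat{\mathcal A}$ and $\mathrm{ran}(R)=\hat{\mathcal B}$.
   Context: Fix a vocabulary $L$ and a class $\mathcal K$ of $L$-structures; $\Phi$ is the set of atomic $L$-formulas (no equality). $L$ has approximations for $\mathcal K$: there are a dense set $D\subseteq[0,\infty)$ with $0\in D$, closed under addition, and maps $\mathrm{Appr}\colon\Phi\times D\to\Phi$, $\mathrm{neg}\colon\Phi\to\Phi$ such that (for all $\varphi\in\Phi$, $\mathcal A\in\mathcal K$, tuples $\bar a$, $\varepsilon,\delta\in D$): $\mathrm{Appr}(\varphi,\varepsilon)$, $\mathrm{neg}(\varphi)$ have the same variables as $\varphi$; $\mathrm{Appr}(\varphi,0)\equiv\varphi$; $\mathrm{Appr}(\mathrm{Appr}(\varphi,\varepsilon),\delta)\equiv\mathrm{Appr}(\varphi,\varepsilon+\delta)$; $\varphi\models\mathrm{Appr}(\varphi,\varepsilon)$; $\mathcal A\models\varphi(\bar a)$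 iff $\mathcal A\models\mathrm{Appr}(\varphi,\varepsilon)(\bar a)$ for all $\varepsilon\in D\setminus\{0\}$; $\mathrm{neg}(\mathrm{neg}\varphi)=\varphi$; $\mathcal A\not\models\varphi(\bar a)$ iff $\mathcal A\models\mathrm{neg}(\mathrm{Appr}(\varphi,\varepsilon))(\bar a)$ for some $\varepsilon\in D\setminus\{0\}$; for $\varepsilon\geq\delta>0$, $\mathrm{Appr}(\mathrm{neg}(\mathrm{Appr}(\varphi,\varepsilon)),\delta)\equiv\mathrm{neg}(\mathrm{Appr}(\varphi,\varepsilon-\delta))$. Each $\mathcal A\in\mathcal K$ carries a complete metric such that each relation $d(a,a')\leq r$, $r\in D$, is defined by an atomic formula; density and separability refer to it. All real parameters range over $D$. A correspondence notion is a family $\mathcal R=(\mathcal R_\varepsilon)_{\varepsilon\geq0}$ of sets of relations such that: each $R\in\mathcal R_\varepsilon$ is a relation $R\subseteq\mathcal A\times\mathcal B$ for some $\mathcal A,\mathcal B\in\mathcal K$ with $\mathrm{dom}(R)$ dense in $\mathcal A$ and $\mathrm{ran}(R)$ dense in $\mathcal B$ (then $R$ is an $\varepsilon$-correspondence between $\mathcal A$ and $\mathcal B$); every $L$-isomorphism between members of $\mathcal K$ is in $\mathcal R_0$; $R\in\mathcal R_\varepsilon$ iff $R^{-1}\in\mathcal R_\varepsilon$; if there are an $\varepsilon$-correspondence between $\mathcal A$ and $\mathcal B$ and an $\varepsilon'$-correspondence between $\mathcal B$ and $\mathcal C$, then there is an $(\varepsilon+\varepsilon')$-correspondence between $\mathcal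 A$ and $\mathcal C$; and for $\mathcal A,\mathcal B\in\mathcal K$, $\varepsilon>0$ and dense sets $\hat{\mathcal A}\subseteq\mathcal A$, $\hat{\mathcal B}\subseteq\mathcal B$, the following are equivalent: (a) there are $\varepsilon'\in(0,\varepsilon)$ and $R\in\mathcal R_{\varepsilon'}$ with $\mathrm{dom}(R)=\hat{\mathcal A}$, $\mathrm{ran}(R)=\hat{\mathcal B}$; (b) there are $\varepsilon'\in(0,\varepsilon)$ and a relation $R$ with domain $\hat{\mathcal A}$ and range $\hat{\mathcal B}$ such that for all atomic $\varphi(v_0,\dots,v_{m-1})$ and $(a_i,b_i)\in R$ ($i<m$), $\mathcal A\models\varphi(\bar a)\Rightarrow\mathcal B\models\mathrm{Appr}(\varphi,\varepsilon')(\bar b)$. The game $\mathrm{EFR}^{\omega,\varepsilon}(\hat{\mathcal A},\hat{\mathcal B})$ for dense $\hat{\mathcal A}\subseteq\mathcal A$, $\hat{\mathcal B}\subseteq\mathcal B$ (treated as disjoint) has $\omega$ rounds; in each round I picks an element of $\hat{\mathcal A}\cup\hat{\mathcal B}$ and II answers with an element of the other set; letting $a_i\in\hat{\mathcal A}$, $b_i\in\hat{\mathcal B}$ be the elements played in round $i$, II wins iff for all indices $i_0,\dots,i_{m-1}<\omega$ and all atomic $\varphi(v_0,\dots,v_{m-1})$: $\mathcal A\models\varphi(a_{i_0},\dots,a_{i_{m-1}})\Rightarrow\mathcal B\models\mathrm{Appr}(\varphi,\varepsilon)(b_{i_0},\dots,b_{i_{m-1}})$. *)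

theory Defs
  imports "HOL-Analysis.Analysis"
begin

section \<open>Vocabularies, atomic formulas and structures\<close>

record ('f, 'r) vocabulary =
  funs :: "'f set"
  rels :: "'r set"
  fun_arity :: "'f \<Rightarrow> nat"
  rel_arity :: "'r \<Rightarrow> nat"

text \<open>The variable \<open>v\<^sub>i\<close> is \<open>Var i\<close>. Constants are function symbols of arity 0.
  There is no equality symbol.\<close>

datatype 'f trm = Var nat | App 'f "'f trm list"

datatype ('f, 'r) atom = Rel 'r "'f trm list"

fun trm_vars :: "'f trm \<Rightarrow> nat set" where
  "trm_vars (Var i) = {i}"
| "trm_vars (App f ts) = (\<Union>t\<in>set ts. trm_vars t)"

fun atom_vars :: "('f, 'r) atom \<Rightarrow> nat set" where
  "atom_vars (Rel r ts) = (\<Union>t\<in>set ts. trm_vars t)"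

fun wf_trm :: "('f, 'r) vocabulary \<Rightarrow> 'f trm \<Rightarrow> bool" where
  "wf_trm L (Var i) \<longleftrightarrow> True"
| "wf_trm L (App f ts) \<longleftrightarrow>
     f \<in> funs L \<and> length ts = fun_arity L f \<and> (\<forall>t\<in>set ts. wf_trm L t)"

definition atomic_formulas :: "('f, 'r) vocabulary \<Rightarrow> ('f, 'r) atom set" where
  "atomic_formulas L =
     {Rel r ts | r ts. r \<in> rels L \<and> length ts = rel_arity L r \<and> (\<forall>t\<in>set ts. wf_trm L t)}"

record ('a, 'f, 'r) struct =
  universe :: "'a set"
  fun_int :: "'f \<Rightarrow> 'a list \<Rightarrow> 'a"
  rel_int :: "'r \<Rightarrow> 'a list set"

definition tuples :: "'a set \<Rightarrow> nat \<Rightarrow> 'a list set" where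
  "tuples U n = {xs. length xs = n \<and> set xs \<subseteq> U}"

definition is_structure :: "('f, 'r) vocabulary \<Rightarrow> ('a, 'f, 'r) struct \<Rightarrow> bool" where
  "is_structure L A \<longleftrightarrow>
     universe A \<noteq> {} \<and>
     (\<forall>f\<in>funs L. \<forall>xs\<in>tuples (universe A) (fun_arity L f). fun_int A f xs \<in> universe A) \<and>
     (\<forall>r\<in>rels L. rel_int A r \<subseteq> tuples (universe A) (rel_arity L r))"

fun trm_val :: "('a, 'f, 'r) struct \<Rightarrow> (nat \<Rightarrow> 'a) \<Rightarrow> 'f trm \<Rightarrow> 'a" where
  "trm_val A s (Var i) = s i"
| "trm_val A s (App f ts) = fun_int A f (map (trm_val A s) ts)"

fun sat :: "('a, 'f, 'r) struct \<Rightarrow> (nat \<Rightarrow> 'a) \<Rightarrow> ('f, 'r) atom \<Rightarrow> bool" where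
  "sat A s (Rel r ts) \<longleftrightarrow> map (trm_val A s) ts \<in> rel_int A r"

definition entails_in ::
  "('a, 'f, 'r) struct set \<Rightarrow> ('f, 'r) atom \<Rightarrow> ('f, 'r) atom \<Rightarrow> bool" where
  "entails_in K \<phi> \<psi> \<longleftrightarrow> (\<forall>A\<in>K. \<forall>s. range s \<subseteq> universe A \<longrightarrow> sat A s \<phi> \<longrightarrow> sat A s \<psi>)"

definition equiv_in ::
  "('a, 'f, 'r) struct set \<Rightarrow> ('f, 'r) atom \<Rightarrow> ('f, 'r) atom \<Rightarrow> bool" where
  "equiv_in K \<phi> \<psi> \<longleftrightarrow> (\<forall>A\<in>K. \<forall>s. range s \<subseteq> universe A \<longrightarrow> (sat A s \<phi> \<longleftrightarrow> sat A s \<psi>))"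

definition isomorphism ::
  "('f, 'r) vocabulary \<Rightarrow> ('a, 'f, 'r) struct \<Rightarrow> ('a, 'f, 'r) struct \<Rightarrow> ('a \<Rightarrow> 'a) \<Rightarrow> bool" where
  "isomorphism L A B h \<longleftrightarrow>
     bij_betw h (universe A) (universe B) \<and>
     (\<forall>f\<in>funs L. \<forall>xs\<in>tuples (universe A) (fun_arity L f).
        h (fun_int A f xs) = fun_int B f (map h xs)) \<and>
     (\<forall>r\<in>rels L. \<forall>xs\<in>tuples (universe A) (rel_arity L r).
        xs \<in> rel_int A r \<longleftrightarrow> map h xs \<in> rel_int B r)"

definition dense_subset :: "'a metric \<Rightarrow> 'a set \<Rightarrow> bool" where
  "dense_subset m S \<longleftrightarrow> S \<subseteq> mspace m \<and> mtopology_of m closure_of S = mspace m"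


section \<open>Approximations\<close>

text \<open>\<open>Appr\<close> and \<open>neg\<close> are total functions in HOL; they are constrained only on atomic
  \<open>L\<close>-formulas and on parameters from \<open>D\<close>. In \<open>Appr_neg_Appr\<close> the
  side condition \<open>\<epsilon> - \<delta> \<in> D\<close> is what makes \<open>Appr \<phi> (\<epsilon> - \<delta>)\<close> meaningful:
  \<open>D\<close> need not be closed under subtraction.

  The formula defining \<open>d(a,a') \<le> r\<close> may depend on the structure; the case of one formula
  for the whole class is included.\<close>

locale approximation_framework =
  fixes L :: "('f, 'r) vocabulary"
    and K :: "('a, 'f, 'r) struct set"
    and D :: "real set"
    and Appr :: "('f, 'r) atom \<Rightarrow> real \<Rightarrow> ('f, 'r) atom"
    and neg :: "('f, 'r) atom \<Rightarrow> ('f, 'r) atom"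
    and met :: "('a, 'f, 'r) struct \<Rightarrow> 'a metric"
  assumes structures: "A \<in> K \<Longrightarrow> is_structure L A"
    and D_nonneg: "D \<subseteq> {0..}"
    and D_dense: "{0..} \<subseteq> closure D"
    and D_zero: "0 \<in> D"
    and D_add: "\<lbrakk>\<epsilon> \<in> D; \<delta> \<in> D\<rbrakk> \<Longrightarrow> \<epsilon> + \<delta> \<in> D"
    and Appr_atomic: "\<lbrakk>\<phi> \<in> atomic_formulas L; \<epsilon> \<in> D\<rbrakk> \<Longrightarrow> Appr \<phi> \<epsilon> \<in> atomic_formulas L"
    and neg_atomic: "\<phi> \<in> atomic_formulas L \<Longrightarrow> neg \<phi> \<in> atomic_formulas L"
    and Appr_vars: "\<lbrakk>\<phi> \<in> atomic_formulas L; \<epsilon> \<in> D\<rbrakk> \<Longrightarrow> atom_vars (Appr \<phi> \<epsilon>) = atom_vars \<phi>"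
    and neg_vars: "\<phi> \<in> atomic_formulas L \<Longrightarrow> atom_vars (neg \<phi>) = atom_vars \<phi>"
    and Appr_zero: "\<phi> \<in> atomic_formulas L \<Longrightarrow> equiv_in K (Appr \<phi> 0) \<phi>"
    and Appr_Appr: "\<lbrakk>\<phi> \<in> atomic_formulas L; \<epsilon> \<in> D; \<delta> \<in> D\<rbrakk>
          \<Longrightarrow> equiv_in K (Appr (Appr \<phi> \<epsilon>) \<delta>) (Appr \<phi> (\<epsilon> + \<delta>))"
    and Appr_weaker: "\<lbrakk>\<phi> \<in> atomic_formulas L; \<epsilon> \<in> D\<rbrakk> \<Longrightarrow> entails_in K \<phi> (Appr \<phi> \<epsilon>)"
    and sat_iff_Appr: "\<lbrakk>\<phi> \<in> atomic_formulas L; A \<in> K; range s \<subseteq> universe A\<rbrakk>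
          \<Longrightarrow> sat A s \<phi> \<longleftrightarrow> (\<forall>\<epsilon>\<in>D - {0}. sat A s (Appr \<phi> \<epsilon>))"
    and neg_neg: "\<phi> \<in> atomic_formulas L \<Longrightarrow> neg (neg \<phi>) = \<phi>"
    and not_sat_iff_neg: "\<lbrakk>\<phi> \<in> atomic_formulas L; A \<in> K; range s \<subseteq> universe A\<rbrakk>
          \<Longrightarrow> \<not> sat A s \<phi> \<longleftrightarrow> (\<exists>\<epsilon>\<in>D - {0}. sat A s (neg (Appr \<phi> \<epsilon>)))"
    and Appr_neg_Appr:
          "\<lbrakk>\<phi> \<in> atomic_formulas L; \<epsilon> \<in> D; \<delta> \<in> D; \<epsilon> - \<delta> \<in> D; \<epsilon> \<ge> \<delta>; \<delta> > 0\<rbrakk>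
          \<Longrightarrow> equiv_in K (Appr (neg (Appr \<phi> \<epsilon>)) \<delta>) (neg (Appr \<phi> (\<epsilon> - \<delta>)))"
    and met_universe: "A \<in> K \<Longrightarrow> mspace (met A) = universe A"
    and met_complete: "A \<in> K \<Longrightarrow> mcomplete_of (met A)"
    and met_definable: "\<lbrakk>A \<in> K; r \<in> D\<rbrakk> \<Longrightarrow>
          \<exists>\<phi>\<in>atomic_formulas L. atom_vars \<phi> \<subseteq> {0, 1} \<and>
            (\<forall>s. range s \<subseteq> universe A \<longrightarrow> (sat A s \<phi> \<longleftrightarrow> mdist (met A) (s 0) (s 1) \<le> r))"


section \<open>Correspondence notions\<close>

text \<open>For \<open>\<phi>(v\<^sub>0,\<dots>,v\<^sub>m\<^sub>-\<^sub>1)\<close>, only the values of \<open>a\<close> and \<open>b\<close> below \<open>m\<close> matter.\<close>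

definition approx_preserving ::
  "('f, 'r) vocabulary \<Rightarrow> (('f, 'r) atom \<Rightarrow> real \<Rightarrow> ('f, 'r) atom) \<Rightarrow> real \<Rightarrow>
   ('a, 'f, 'r) struct \<Rightarrow> ('a, 'f, 'r) struct \<Rightarrow> 'a rel \<Rightarrow> bool" where
  "approx_preserving L Appr \<epsilon> A B R \<longleftrightarrow>
     (\<forall>\<phi>\<in>atomic_formulas L. \<forall>m a b.
        atom_vars \<phi> \<subseteq> {..<m} \<longrightarrow> (\<forall>i<m. (a i, b i) \<in> R) \<longrightarrow>
        sat A a \<phi> \<longrightarrow> sat B b (Appr \<phi> \<epsilon>))"

text \<open>A relation between \<open>A\<close> and \<open>B\<close> is understood together with its source and
  target structure: \<open>(A, B, R) \<in> Corr \<epsilon>\<close> means that \<open>R \<in> \<R>\<^sub>\<epsilon>\<close> is an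
  \<open>\<epsilon>\<close>-correspondence between \<open>A\<close> and \<open>B\<close>. A bare set of pairs does not determine the
  structures, since different members of \<open>K\<close> may share their universe. A family of bare sets
  of pairs is covered by taking all triples for which \<open>R\<close> is a densely defined relation
  with dense range.\<close>

locale correspondence_notion = approximation_framework L K D Appr neg met
  for L :: "('f, 'r) vocabulary"
    and K :: "('a, 'f, 'r) struct set"
    and D Appr neg met +
  fixes Corr :: "real \<Rightarrow> (('a, 'f, 'r) struct \<times> ('a, 'f, 'r) struct \<times> 'a rel) set"
  assumes Corr_dense: "\<lbrakk>\<epsilon> \<in> D; (A, B, R) \<in> Corr \<epsilon>\<rbrakk> \<Longrightarrow>
          A \<in> K \<and> B \<in> K \<and> R \<subseteq> universe A \<times> universe B \<and>
          dense_subset (met A) (Domain R) \<and> dense_subset (met B) (Range R)"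
    and Corr_isomorphism: "\<lbrakk>A \<in> K; B \<in> K; isomorphism L A B h\<rbrakk> \<Longrightarrow>
          (A, B, {(a, h a) | a. a \<in> universe A}) \<in> Corr 0"
    and Corr_converse: "\<epsilon> \<in> D \<Longrightarrow> (A, B, R) \<in> Corr \<epsilon> \<longleftrightarrow> (B, A, R\<inverse>) \<in> Corr \<epsilon>"
    and Corr_trans: "\<lbrakk>\<epsilon> \<in> D; \<epsilon>' \<in> D; \<exists>R. (A, B, R) \<in> Corr \<epsilon>; \<exists>R. (B, C, R) \<in> Corr \<epsilon>'\<rbrakk> \<Longrightarrow>
          \<exists>R. (A, C, R) \<in> Corr (\<epsilon> + \<epsilon>')"
    and Corr_iff_approx:
          "\<lbrakk>A \<in> K; B \<in> K; \<epsilon> \<in> D; \<epsilon> > 0; dense_subset (met A) Ah; dense_subset (met B) Bh\<rbrakk> \<Longrightarrow>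
          (\<exists>\<epsilon>'\<in>D \<inter> {0<..<\<epsilon>}. \<exists>R. (A, B, R) \<in> Corr \<epsilon>' \<and> Domain R = Ah \<and> Range R = Bh) \<longleftrightarrow>
          (\<exists>\<epsilon>'\<in>D \<inter> {0<..<\<epsilon>}. \<exists>R. Domain R = Ah \<and> Range R = Bh \<and>
             approx_preserving L Appr \<epsilon>' A B R)"


section \<open>The game\<close>

text \<open>Player I's moves live in the disjoint sum \<open>Ah <+> Bh\<close>. The side on which II has to
  answer is determined by I's move, so an answer is given by its underlying element only.\<close>

fun round_pair :: "'a + 'a \<Rightarrow> 'a \<Rightarrow> 'a \<times> 'a" where
  "round_pair (Inl a) y = (a, y)"
| "round_pair (Inr b) y = (y, b)"

text \<open>A strategy of II gives the answer as a function of I's moves so far, the current one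
  included.\<close>

definition play :: "(('a + 'a) list \<Rightarrow> 'a) \<Rightarrow> (nat \<Rightarrow> 'a + 'a) \<Rightarrow> nat \<Rightarrow> 'a \<times> 'a" where
  "play \<sigma> x n = round_pair (x n) (\<sigma> (map x [0..<Suc n]))"

definition EFR_II_wins_play ::
  "('f, 'r) vocabulary \<Rightarrow> (('f, 'r) atom \<Rightarrow> real \<Rightarrow> ('f, 'r) atom) \<Rightarrow> real \<Rightarrow>
   ('a, 'f, 'r) struct \<Rightarrow> ('a, 'f, 'r) struct \<Rightarrow> (nat \<Rightarrow> 'a \<times> 'a) \<Rightarrow> bool" where
  "EFR_II_wins_play L Appr \<epsilon> A B p \<longleftrightarrow>
     (\<forall>i :: nat \<Rightarrow> nat. \<forall>\<phi>\<in>atomic_formulas L.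
        sat A (\<lambda>k. fst (p (i k))) \<phi> \<longrightarrow> sat B (\<lambda>k. snd (p (i k))) (Appr \<phi> \<epsilon>))"

definition EFR_winning_strategy ::
  "('f, 'r) vocabulary \<Rightarrow> (('f, 'r) atom \<Rightarrow> real \<Rightarrow> ('f, 'r) atom) \<Rightarrow> real \<Rightarrow>
   ('a, 'f, 'r) struct \<Rightarrow> ('a, 'f, 'r) struct \<Rightarrow> 'a set \<Rightarrow> 'a set \<Rightarrow>
   (('a + 'a) list \<Rightarrow> 'a) \<Rightarrow> bool" where
  "EFR_winning_strategy L Appr \<epsilon> A B Ah Bh \<sigma> \<longleftrightarrow>
     (\<forall>x. range x \<subseteq> Ah <+> Bh \<longrightarrow>
        (\<forall>n. play \<sigma> x n \<in> Ah \<times> Bh) \<and> EFR_II_wins_play L Appr \<epsilon> A B (play \<sigma> x))"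

end

theory Submission
  imports Defs
begin

text \<open>By the last axiom on correspondence notions, (2) may be replaced by the existence of a relation
  with domain \<open>Ah\<close> and range \<open>Bh\<close> that transfers atomic formulas up to \<open>\<epsilon>'\<close>. Such a relation is
  a positional strategy for II. Conversely, as \<open>Ah\<close> and \<open>Bh\<close> are countable, I can play all their
  elements in a single run, and the pairs played when II follows a winning strategy form the
  relation.\<close>

lemma trm_val_cong:
  "(\<And>i. i \<in> trm_vars t \<Longrightarrow> s i = s' i) \<Longrightarrow> trm_val A s t = trm_val A s' t"
proof (induction t)
  case (App f ts)
  then have "map (trm_val A s) ts = map (trm_val A s') ts"
    by fastforce
  then show ?case
    by (simp only: trm_val.simps)
qed simp

text \<open>Assignments are total functions while tuples are finite, so entries at indices that do
  not occur in \<open>\<phi>\<close> must be exchangeable at will.\<close>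

lemma sat_cong:
  assumes "\<And>i. i \<in> atom_vars \<phi> \<Longrightarrow> s i = s' i"
  shows "sat A s \<phi> \<longleftrightarrow> sat A s' \<phi>"
proof (cases \<phi>)
  case (Rel r ts)
  with assms have "map (trm_val A s) ts = map (trm_val A s') ts"
    by (auto intro!: trm_val_cong)
  then show ?thesis
    using Rel by (simp only: sat.simps)
qed

lemma finite_trm_vars: "finite (trm_vars t)"
  by (induction t) auto

text \<open>The winning condition uses infinite sequences of round indices;
  \<open>approx_preserving\<close> speaks of tuples of some length \<open>m\<close>. This supplies
  an \<open>m\<close>.\<close>

lemma atom_vars_bounded: "\<exists>m. atom_vars \<phi> \<subseteq> {..<m}"
proof -
  have "finite (atom_vars \<phi>)"
    by (cases \<phi>) (auto intro: finite_trm_vars)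
  then show ?thesis
    by (metis finite_nat_iff_bounded)
qed

context approximation_framework
begin

text \<open>The winning condition allows arbitrary sequences of rounds, with repetitions, so every
  finite tuple of played pairs is an instance of it.\<close>

lemma winning_play_imp_approx_preserving:
  assumes win: "EFR_II_wins_play L Appr \<epsilon> A B p" and \<epsilon>: "\<epsilon> \<in> D"
  shows "approx_preserving L Appr \<epsilon> A B (range p)"
  unfolding approx_preserving_def
proof (intro ballI allI impI)
  fix \<phi> m a b
  assume \<phi>: "\<phi> \<in> atomic_formulas L" and vars: "atom_vars \<phi> \<subseteq> {..<m}"
    and ab: "\<forall>i<m. (a i, b i) \<in> range p" and sat: "sat A a \<phi>"
  \<comment> \<open>For each position below \<open>m\<close>, choose a round in which that pair was
    played.\<close>
  from ab have "\<forall>k. \<exists>j. k < m \<longrightarrow> p j = (a k, b k)"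
    by (fastforce elim!: rangeE)
  then obtain i where i: "\<And>k. k < m \<Longrightarrow> p (i k) = (a k, b k)"
    by metis
  have "sat A (\<lambda>k. fst (p (i k))) \<phi> \<longleftrightarrow> sat A a \<phi>"
    using vars i by (intro sat_cong) auto
  with sat win \<phi> have "sat B (\<lambda>k. snd (p (i k))) (Appr \<phi> \<epsilon>)"
    unfolding EFR_II_wins_play_def by (auto dest!: spec[of _ i])
  \<comment> \<open>The played elements match \<open>b\<close> only below \<open>m\<close>; this
    suffices because \<open>Appr\<close> adds no variables.\<close>
  moreover have "sat B (\<lambda>k. snd (p (i k))) (Appr \<phi> \<epsilon>) \<longleftrightarrow> sat B b (Appr \<phi> \<epsilon>)"
    using vars i Appr_vars[OF \<phi> \<epsilon>] by (intro sat_cong) auto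
  ultimately show "sat B b (Appr \<phi> \<epsilon>)"
    by simp
qed

lemma winning_strategy_imp_approx_preserving:
  assumes win: "EFR_winning_strategy L Appr \<epsilon> A B Ah Bh \<sigma>" and \<epsilon>: "\<epsilon> \<in> D"
    and countable: "countable Ah" "countable Bh" and nonempty: "Ah \<noteq> {}"
  shows "\<exists>R. Domain R = Ah \<and> Range R = Bh \<and> approx_preserving L Appr \<epsilon> A B R"
proof (intro exI conjI)
  \<comment> \<open>One run for I through all elements of both sets; repetitions, as in the finite
    case, do no harm.\<close>
  define x where "x = from_nat_into (Ah <+> Bh)"
  have x: "range x = Ah <+> Bh"
    unfolding x_def using countable nonempty by (intro range_from_nat_into) auto
  have play: "play \<sigma> x n \<in> Ah \<times> Bh" for n
    using win x unfolding EFR_winning_strategy_def by blast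
  have "a \<in> fst ` range (play \<sigma> x)" if "a \<in> Ah" for a
  proof -
    obtain n where "x n = Inl a"
      using \<open>a \<in> Ah\<close> x by (metis InlI imageE)
    \<comment> \<open>I's own move fills its side of the pair, whatever \<open>\<sigma>\<close>
      answers.\<close>
    then have "fst (play \<sigma> x n) = a"
      by (simp add: play_def)
    then show ?thesis
      by blast
  qed
  moreover have "fst ` range (play \<sigma> x) \<subseteq> Ah"
    using play by (auto simp: mem_Times_iff)
  ultimately show "Domain (range (play \<sigma> x)) = Ah"
    unfolding Domain_fst by blast
  have "b \<in> snd ` range (play \<sigma> x)" if "b \<in> Bh" for b
  proof -
    obtain n where "x n = Inr b"
      using \<open>b \<in> Bh\<close> x by (metis InrI imageE)
    then have "snd (play \<sigma> x n) = b"
      by (simp add: play_def)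
    then show ?thesis
      by blast
  qed
  moreover have "snd ` range (play \<sigma> x) \<subseteq> Bh"
    using play by (auto simp: mem_Times_iff)
  ultimately show "Range (range (play \<sigma> x)) = Bh"
    unfolding Range_snd by blast
  show "approx_preserving L Appr \<epsilon> A B (range (play \<sigma> x))"
    using win x \<epsilon> unfolding EFR_winning_strategy_def
    by (intro winning_play_imp_approx_preserving) auto
qed

end

text \<open>If every answer keeps the current pair inside \<open>R\<close>, then all pairs of the
  play lie in \<open>R\<close>, and winning is an instance of preservation.\<close>

lemma approx_preserving_imp_winning_strategy:
  assumes R: "Domain R = Ah" "Range R = Bh" and pres: "approx_preserving L Appr \<epsilon> A B R"
  shows "\<exists>\<sigma>. EFR_winning_strategy L Appr \<epsilon> A B Ah Bh \<sigma>"
proof -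
  have "\<forall>z. \<exists>y. z \<in> Ah <+> Bh \<longrightarrow> round_pair z y \<in> R"
    using R by fastforce
  then obtain g where g: "\<And>z. z \<in> Ah <+> Bh \<Longrightarrow> round_pair z (g z) \<in> R"
    by metis
  \<comment> \<open>The history given to a strategy ends with the current move, so
    \<open>last\<close> makes the strategy positional.\<close>
  have "EFR_winning_strategy L Appr \<epsilon> A B Ah Bh (\<lambda>zs. g (last zs))"
    unfolding EFR_winning_strategy_def
  proof (intro allI impI)
    fix x :: "nat \<Rightarrow> 'a + 'a"
    assume "range x \<subseteq> Ah <+> Bh"
    then have in_R: "play (\<lambda>zs. g (last zs)) x n \<in> R" for n
      using g[of "x n"] by (simp add: play_def range_subsetD)
    have "EFR_II_wins_play L Appr \<epsilon> A B (play (\<lambda>zs. g (last zs)) x)"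
      unfolding EFR_II_wins_play_def
    proof (intro allI ballI impI)
      fix i :: "nat \<Rightarrow> nat" and \<phi>
      let ?p = "\<lambda>k. play (\<lambda>zs. g (last zs)) x (i k)"
      assume \<phi>: "\<phi> \<in> atomic_formulas L" and sat: "sat A (\<lambda>k. fst (?p k)) \<phi>"
      obtain m where "atom_vars \<phi> \<subseteq> {..<m}"
        using atom_vars_bounded by blast
      moreover have "\<forall>k<m. (fst (?p k), snd (?p k)) \<in> R"
        using in_R by simp
      ultimately show "sat B (\<lambda>k. snd (?p k)) (Appr \<phi> \<epsilon>)"
        using pres[unfolded approx_preserving_def, THEN bspec, OF \<phi>,
            THEN spec, of m, THEN spec, of "\<lambda>k. fst (?p k)", THEN spec, of "\<lambda>k. snd (?p k)"]
          sat by iprover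
    qed
    moreover have "R \<subseteq> Ah \<times> Bh"
      using R by auto
    ultimately show "(\<forall>n. play (\<lambda>zs. g (last zs)) x n \<in> Ah \<times> Bh) \<and>
        EFR_II_wins_play L Appr \<epsilon> A B (play (\<lambda>zs. g (last zs)) x)"
      using in_R by blast
  qed
  then show ?thesis
    by blast
qed

theorem theorem4p18:
  fixes L :: "('f, 'r) vocabulary"
    and K :: "('a, 'f, 'r) struct set"
    and A B :: "('a, 'f, 'r) struct"
    and Ah Bh :: "'a set"
    and \<epsilon> :: real
  assumes "correspondence_notion L K D Appr neg met Corr"
    and "A \<in> K" and "B \<in> K"
    and "separable_space (mtopology_of (met A))"
    and "separable_space (mtopology_of (met B))"
    and "countable Ah" and "dense_subset (met A) Ah"
    and "countable Bh" and "dense_subset (met B) Bh"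
    and "\<epsilon> \<in> D" and "\<epsilon> > 0"
  shows "(\<exists>\<epsilon>'\<in>D \<inter> {0<..<\<epsilon>}. \<exists>\<sigma>. EFR_winning_strategy L Appr \<epsilon>' A B Ah Bh \<sigma>) \<longleftrightarrow>
         (\<exists>\<epsilon>'\<in>D \<inter> {0<..<\<epsilon>}. \<exists>R. (A, B, R) \<in> Corr \<epsilon>' \<and> Domain R = Ah \<and> Range R = Bh)"
proof -
  interpret correspondence_notion L K D Appr neg met Corr
    by fact
  \<comment> \<open>A dense subset of a nonempty space is nonempty, so I's moves can be
    enumerated.\<close>
  have "mspace (met A) \<noteq> {}"
    using structures[OF \<open>A \<in> K\<close>] met_universe[OF \<open>A \<in> K\<close>] by (simp add: is_structure_def)
  then have "Ah \<noteq> {}"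
    using \<open>dense_subset (met A) Ah\<close> by (auto simp: dense_subset_def)
  \<comment> \<open>Strategies and relations correspond at the same \<open>\<epsilon>'\<close>; only
    \<open>Corr_iff_approx\<close> may change its value below \<open>\<epsilon>\<close>.\<close>
  then have "(\<exists>\<sigma>. EFR_winning_strategy L Appr \<epsilon>' A B Ah Bh \<sigma>) \<longleftrightarrow>
      (\<exists>R. Domain R = Ah \<and> Range R = Bh \<and> approx_preserving L Appr \<epsilon>' A B R)"
    if "\<epsilon>' \<in> D" for \<epsilon>'
    using winning_strategy_imp_approx_preserving[OF _ that \<open>countable Ah\<close> \<open>countable Bh\<close>]
      approx_preserving_imp_winning_strategy \<open>Ah \<noteq> {}\<close> by blast
  then show ?thesis
    unfolding Corr_iff_approx[OF \<open>A \<in> K\<close> \<open>B \<in> K\<close> \<open>\<epsilon> \<in> D\<close> \<open>\<epsilon> > 0\<close>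
        \<open>dense_subset (met A) Ah\<close> \<open>dense_subset (met B) Bh\<close>]
    by auto
qed

end
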